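(* Let $n\geq 1$ be an integer. The partition of the vertices of $\mathcal{M}(K_{2n})$ according to their type is equitable.
   Context: $K_{2n}$ is the complete graph on the $2n$ vertices $0^{+},0^{-},1^{+},1^{-},\dots,(n-1)^{+},(n-1)^{-}$. The flip graph $\mathcal{M}(K_{2n})$ is the graph whose vertices are the perfect matchings of $K_{2n}$, where two perfect matchings are adjacent if their symmetric difference (as edge sets) is a cycle of length $4$. The identity perfect matching is $M_0=\{\{0^{+},0^{-}\},\dots,\{(n-1)^{+},(n-1)^{-}\}\}$. For a perfect matching $M$, the multigraph union $M_0\cup M$ is a disjoint union of cycles of even lengths $2\lambda_1\geq\cdots\geq 2\lambda_k$ (an edge lying in both $M_0$ and $M$ gives a cycle of length $2$); the partition $(\lambda_1,\dots,\lambda_k)$ of $n$ is called the type of $M$. A partition $V=X_1\cup\dots\cup X_t$ of the vertex set of a graph is equitable if there exist non-negative integers $b_{i,j}$, $1\leq i,j\leq t$, such that for all $i,j$ and every vertex $x\in X_i$, the number of neighbors of $x$ contained in $X_j$ equals $b_{i,j}$. *)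

theory Defs
  imports Main "HOL-Library.Multiset" "HOL-Library.Disjoint_Sets"
begin

(* The pair (i, True) stands for the vertex i^+ and (i, False) for i^-. *)
type_synonym vertex = "nat \<times> bool"
type_synonym edge = "vertex set"

definition verts :: "nat \<Rightarrow> vertex set" where
  "verts n = {..<n} \<times> UNIV"

definition complete_edges :: "nat \<Rightarrow> edge set" where
  "complete_edges n = {e. e \<subseteq> verts n \<and> card e = 2}"

definition perfect_matchings :: "nat \<Rightarrow> edge set set" where
  "perfect_matchings n =
     {M. M \<subseteq> complete_edges n \<and> (\<forall>v\<in>verts n. \<exists>!e. e \<in> M \<and> v \<in> e)}"

definition identity_matching :: "nat \<Rightarrow> edge set" where
  "identity_matching n = (\<lambda>i. {(i, True), (i, False)}) ` {..<n}"

(* A cycle is given by the cyclic list of its vertices. Its edges form a multiset: the list [u, v]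
   is the cycle of length 2 that consists of two parallel copies of {u, v}. *)
definition is_cycle :: "'a list \<Rightarrow> bool" where
  "is_cycle vs \<longleftrightarrow> distinct vs \<and> length vs \<ge> 2"

definition cycle_edges :: "'a list \<Rightarrow> 'a set multiset" where
  "cycle_edges vs = mset (map2 (\<lambda>u v. {u, v}) vs (rotate1 vs))"

definition flip_adj :: "edge set \<Rightarrow> edge set \<Rightarrow> bool" where
  "flip_adj M N \<longleftrightarrow>
     (\<exists>vs. is_cycle vs \<and> length vs = 4 \<and> (M - N) \<union> (N - M) = set_mset (cycle_edges vs))"

(* The multigraph union of the identity matching and M is the sum of their edge multisets.
   Distinctness of the concatenated list cs says that the cycles are pairwise vertex-disjoint;
   they cover all vertices because the identity matching does. *)
definition has_type :: "nat \<Rightarrow> edge set \<Rightarrow> nat list \<Rightarrow> bool" where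
  "has_type n M ls \<longleftrightarrow>
     sorted_wrt (\<ge>) ls \<and>
     (\<exists>cs. (\<forall>c\<in>set cs. is_cycle c) \<and> distinct (concat cs) \<and>
           mset_set (identity_matching n) + mset_set M = sum_list (map cycle_edges cs) \<and>
           map length cs = map (\<lambda>l. 2 * l) ls)"

definition matchings_of_type :: "nat \<Rightarrow> nat list \<Rightarrow> edge set set" where
  "matchings_of_type n ls = {M \<in> perfect_matchings n. has_type n M ls}"

definition matching_types :: "nat \<Rightarrow> nat list set" where
  "matching_types n = {ls. \<exists>M\<in>perfect_matchings n. has_type n M ls}"

(* That the family X, indexed by I, is a partition of the vertex set V is part of the definition. *)
definition equitable_partition ::
  "'a set \<Rightarrow> ('a \<Rightarrow> 'a \<Rightarrow> bool) \<Rightarrow> 'i set \<Rightarrow> ('i \<Rightarrow> 'a set) \<Rightarrow> bool" where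
  "equitable_partition V adj I X \<longleftrightarrow>
     finite I \<and> (\<Union>i\<in>I. X i) = V \<and> disjoint_family_on X I \<and> (\<forall>i\<in>I. X i \<noteq> {}) \<and>
     (\<exists>b :: 'i \<Rightarrow> 'i \<Rightarrow> nat. \<forall>i\<in>I. \<forall>j\<in>I. \<forall>x\<in>X i. card {y \<in> X j. adj x y} = b i j)"

end

theory Submission
  imports Defs "HOL-Combinatorics.Permutations"
begin

text \<open>
  A permutation \<open>f\<close> of the vertices acts on perfect matchings and preserves symmetric differences,
  so it is an automorphism of the flip graph. If \<open>f\<close> maps the identity matching \<open>M\<^sub>0\<close> to itself,
  it also preserves types, because it carries the cycles of \<open>M\<^sub>0 \<union> M\<close> to those of \<open>M\<^sub>0 \<union> f M\<close>.
  The types are in fact the orbits of these permutations: if \<open>M\<close> and \<open>N\<close> have the same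
  type, the cycles of \<open>M\<^sub>0 \<union> M\<close> can be matched with cycles of \<open>M\<^sub>0 \<union> N\<close> of the same length, and
  walking around both, starting with an \<open>M\<^sub>0\<close>-edge, defines a permutation that maps
  \<open>M\<^sub>0\<close> to \<open>M\<^sub>0\<close> and \<open>M\<close> to \<open>N\<close> (\<open>relabelling_exists\<close>). This permutation injects the flips from
  \<open>M\<close> into a given type into the flips from \<open>N\<close> into that type; by symmetry the two
  numbers of flips agree, so the partition is equitable.

  That types partition the perfect matchings rests on two further facts. Every \<open>M\<close> has a type:
  a maximal path alternating between two perfect matchings closes up to a cycle, and the rest is
  handled by induction (\<open>alternating_decomposition_exists\<close>). The type is unique: the vertex sets
  of the cycles in any decomposition are the connected components of \<open>M\<^sub>0 \<union> M\<close>
  (\<open>components_cycles\<close>), so the cycle lengths are component sizes (\<open>has_type_unique\<close>).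
  Uniqueness also permits replacing an arbitrary cycle decomposition witnessing the type by one
  in which every cycle starts with an \<open>M\<^sub>0\<close>-edge.
\<close>

section \<open>Pairing up consecutive list entries\<close>

fun pair_up :: "'a list \<Rightarrow> 'a set list" where
  "pair_up (x # y # zs) = {x, y} # pair_up zs"
| "pair_up _ = []"

lemma pair_up_append: "even (length xs) \<Longrightarrow> pair_up (xs @ ys) = pair_up xs @ pair_up ys"
  by (induction xs rule: pair_up.induct) auto

lemma pair_up_map: "pair_up (map f xs) = map ((`) f) (pair_up xs)"
  by (induction xs rule: pair_up.induct) auto

lemma pair_up_subset: "e \<in> set (pair_up xs) \<Longrightarrow> e \<subseteq> set xs"
  by (induction xs rule: pair_up.induct) auto

lemma Union_pair_up: "even (length xs) \<Longrightarrow> \<Union> (set (pair_up xs)) = set xs"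
  by (induction xs rule: pair_up.induct) auto

lemma distinct_pair_up: "distinct xs \<Longrightarrow> distinct (pair_up xs)"
proof (induction xs rule: pair_up.induct)
  case (1 x y zs)
  then show ?case using pair_up_subset[of "{x, y}" zs] by auto
qed auto

lemma mset_pair_up_concat:
  "(\<And>c. c \<in> set cs \<Longrightarrow> even (length c)) \<Longrightarrow>
    mset (pair_up (concat cs)) = (\<Sum>c\<leftarrow>cs. mset (pair_up c))"
  by (induction cs) (auto simp: pair_up_append)

text \<open>Read off two entries at a time, the edges of a walk through \<open>xs\<close> and on to \<open>w\<close> fall
  alternately into the pairing of the walk and the pairing of its tail.\<close>

lemma mset_map2_shift:
  "even (length xs) \<Longrightarrow> 
    mset (map2 (\<lambda>u v. {u, v}) xs (tl xs @ [w])) = mset (pair_up xs) + mset (pair_up (tl xs @ [w]))"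
proof (induction xs rule: pair_up.induct)
  case (1 x y zs)
  then show ?case by (cases zs) auto
qed auto

text \<open>Around a cycle of even length the edges alternate between two classes; the second class is
  the first one of the rotated cycle.\<close>

lemma cycle_edges_even:
  assumes "even (length c)"
  shows "cycle_edges c = mset (pair_up c) + mset (pair_up (rotate1 c))"
proof (cases c)
  case (Cons x xs)
  then show ?thesis using mset_map2_shift[OF assms, of x] by (simp add: cycle_edges_def)
qed (simp add: cycle_edges_def)

lemma cycle_edges_map: "cycle_edges (map f c) = image_mset ((`) f) (cycle_edges c)"
  by (simp add: cycle_edges_def rotate1_map zip_map_map multiset.map_comp
      comp_def case_prod_unfold flip: mset_map)

lemma is_cycle_map: "inj f \<Longrightarrow> is_cycle (map f c) \<longleftrightarrow> is_cycle c"
  by (auto simp: is_cycle_def distinct_map inj_on_def)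

section \<open>Alternating cycle decompositions\<close>

definition perfect_matching_on :: "'a set \<Rightarrow> 'a set set \<Rightarrow> bool" where
  "perfect_matching_on V M \<longleftrightarrow>
     (\<forall>e\<in>M. e \<subseteq> V \<and> card e = 2) \<and> (\<forall>v\<in>V. \<exists>!e. e \<in> M \<and> v \<in> e)"

lemma perfect_matchings_eq: "perfect_matchings n = {M. perfect_matching_on (verts n) M}"
  by (auto simp: perfect_matchings_def perfect_matching_on_def complete_edges_def)

lemma perfect_matching_on_unique:
  "\<lbrakk>perfect_matching_on V M; e \<in> M; e' \<in> M; x \<in> e; x \<in> e'\<rbrakk> \<Longrightarrow> e = e'"
  unfolding perfect_matching_on_def by blast

lemma perfect_matching_on_mate:
  assumes "perfect_matching_on V M" "x \<in> V"
  obtains y where "y \<in> V" "y \<noteq> x" "{x, y} \<in> M"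
proof -
  obtain e where e: "e \<in> M" "x \<in> e" "e \<subseteq> V" "card e = 2"
    using assms unfolding perfect_matching_on_def by blast
  then obtain y where "e = {x, y}" "y \<noteq> x"
    by (auto simp: card_2_iff)
  with e that show thesis by auto
qed

lemma perfect_matching_on_Diff:
  assumes "perfect_matching_on V M" "C \<subseteq> M"
  shows "perfect_matching_on (V - \<Union>C) (M - C)"
  unfolding perfect_matching_on_def
proof (intro conjI ballI)
  fix e assume e: "e \<in> M - C"
  then have "e \<inter> \<Union>C = {}"
    using perfect_matching_on_unique[OF assms(1)] assms(2) by blast
  then show "e \<subseteq> V - \<Union>C" using e assms(1) unfolding perfect_matching_on_def by blast
  show "card e = 2" using e assms(1) unfolding perfect_matching_on_def by blast
next
  fix v assume "v \<in> V - \<Union>C"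
  then show "\<exists>!e. e \<in> M - C \<and> v \<in> e"
    using assms(1) unfolding perfect_matching_on_def by blast
qed

text \<open>A path that starts and ends with an edge of \<open>A\<close> and alternates between \<open>A\<close> and \<open>B\<close> is
  followed by the \<open>B\<close>-edge at its last vertex \<open>w\<close>. All inner vertices already lie on a
  \<open>B\<close>-edge of the path, so this edge leads back to the start or out of the path; in the latter
  case the path grows, which can happen only finitely often.\<close>

lemma alternating_path_closes:
  assumes V: "finite V" and A: "perfect_matching_on V A" and B: "perfect_matching_on V B"
  assumes "even (length ms)" "distinct (v # ms @ [w])" "set (v # ms @ [w]) \<subseteq> V"
    "set (pair_up (v # ms @ [w])) \<subseteq> A" "set (pair_up ms) \<subseteq> B"
  shows "\<exists>c. c \<noteq> [] \<and> even (length c) \<and> distinct c \<and> set c \<subseteq> V \<and>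
    set (pair_up c) \<subseteq> A \<and> set (pair_up (rotate1 c)) \<subseteq> B"
  using assms(4-)
proof (induction "card V - length ms" arbitrary: ms w rule: less_induct)
  case less
  let ?c = "v # ms @ [w]"
  from less.prems have "w \<in> V" by simp
  then obtain u where u: "u \<in> V" "u \<noteq> w" "{w, u} \<in> B"
    using perfect_matching_on_mate[OF B] by metis
  have "u \<notin> set ms"
  proof
    assume "u \<in> set ms"
    then obtain e where e: "e \<in> set (pair_up ms)" "u \<in> e"
      using Union_pair_up[OF less.prems(1)] by blast
    then have "e = {w, u}"
      using perfect_matching_on_unique[OF B _ u(3)] less.prems(5) by blast
    with e have "w \<in> set ms" using pair_up_subset by fastforce
    with less.prems(2) show False by simp
  qed
  show ?case
  proof (cases "u = v")
    case True
    then have "set (pair_up (rotate1 ?c)) \<subseteq> B"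
      using u less.prems(1,5) by (simp add: pair_up_append)
    then show ?thesis using less.prems by (intro exI[of _ ?c]) simp
  next
    case False
    with \<open>u \<notin> set ms\<close> u have u_new: "u \<notin> set ?c" by auto
    obtain u' where u': "u' \<in> V" "u' \<noteq> u" "{u, u'} \<in> A"
      using perfect_matching_on_mate[OF A u(1)] by metis
    have ev: "even (length ?c)" using less.prems(1) by simp
    have u'_new: "u' \<notin> set ?c"
    proof
      assume "u' \<in> set ?c"
      then obtain e where e: "e \<in> set (pair_up ?c)" "u' \<in> e"
        using Union_pair_up[OF ev] by blast
      then have "e = {u, u'}"
        using perfect_matching_on_unique[OF A _ u'(3)] less.prems(4) by blast
      with e u_new show False using pair_up_subset[of e ?c] by blast
    qed
    have "length ms < card V"
    proof -
      have "card (set ?c) \<le> card V" by (rule card_mono[OF V less.prems(3)])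
      moreover have "card (set ?c) = length ?c" by (rule distinct_card[OF less.prems(2)])
      ultimately show ?thesis by simp
    qed
    moreover have "pair_up (v # (ms @ [w, u]) @ [u']) = pair_up ?c @ [{u, u'}]"
      using pair_up_append[OF ev, of "[u, u']"] by simp
    ultimately show ?thesis
      using less.hyps[of "ms @ [w, u]" u'] less.prems u u' u_new u'_new
      by (auto simp: pair_up_append insert_commute)
  qed
qed

text \<open>Each list of \<open>cs\<close> is a cycle that starts with an edge of \<open>A\<close>. Since all lists have even
  length, \<open>pair_up (concat cs)\<close> is the concatenation of the lists \<open>pair_up c\<close>.\<close>

definition alternating_decomposition ::
  "'a set \<Rightarrow> 'a set set \<Rightarrow> 'a set set \<Rightarrow> 'a list list \<Rightarrow> bool" where
  "alternating_decomposition V A B cs \<longleftrightarrow>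
     (\<forall>c\<in>set cs. c \<noteq> [] \<and> even (length c)) \<and> distinct (concat cs) \<and> set (concat cs) = V \<and>
     A = set (pair_up (concat cs)) \<and> B = set (pair_up (concat (map rotate1 cs)))"

lemma alternating_decomposition_exists:
  assumes "finite V" "perfect_matching_on V A" "perfect_matching_on V B"
  shows "\<exists>cs. alternating_decomposition V A B cs"
  using assms
proof (induction "card V" arbitrary: V A B rule: less_induct)
  case less
  note A = less.prems(2) and B = less.prems(3)
  show ?case
  proof (cases "V = {}")
    case True
    then have "A = {}" "B = {}" using A B unfolding perfect_matching_on_def
      by fastforce+
    with True have "alternating_decomposition V A B []"
      by (simp add: alternating_decomposition_def)
    then show ?thesis ..
  next
    case False
    then obtain v where "v \<in> V" by blast
    then obtain w where w: "w \<in> V" "w \<noteq> v" "{v, w} \<in> A"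
      using perfect_matching_on_mate[OF A] by metis
    obtain c where c: "c \<noteq> []" "even (length c)" "distinct c" "set c \<subseteq> V"
      "set (pair_up c) \<subseteq> A" "set (pair_up (rotate1 c)) \<subseteq> B"
      using alternating_path_closes[OF less.prems(1) A B, of "[]" v w] \<open>v \<in> V\<close> w by auto
    let ?V = "V - set c" and ?A = "A - set (pair_up c)" and ?B = "B - set (pair_up (rotate1 c))"
    have "card ?V < card V"
      using c(1,4) less.prems(1) by (intro psubset_card_mono) (auto simp: neq_Nil_conv)
    moreover have "perfect_matching_on ?V ?A"
      using perfect_matching_on_Diff[OF A c(5)] Union_pair_up[OF c(2)] by simp
    moreover have "perfect_matching_on ?V ?B"
      using perfect_matching_on_Diff[OF B c(6)] Union_pair_up[of "rotate1 c"] c(2) by simp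
    ultimately obtain cs where "alternating_decomposition ?V ?A ?B cs"
      using less.hyps[of ?V ?A ?B] less.prems(1) by auto
    then have "alternating_decomposition V A B (c # cs)"
      using c by (auto simp: alternating_decomposition_def pair_up_append)
    then show ?thesis ..
  qed
qed

text \<open>Used to list the cycles in the order of decreasing length that a type demands.\<close>

lemma alternating_decomposition_cong_mset:
  assumes "alternating_decomposition V A B cs" "mset cs' = mset cs"
  shows "alternating_decomposition V A B cs'"
proof -
  have m: "mset (concat cs') = mset (concat cs)"
    using assms(2) by (metis mset_concat sum_mset_sum_list mset_map)
  have s: "set cs' = set cs" using assms(2) by (metis set_mset_mset)
  have pairs: "set (pair_up (concat xs')) = set (pair_up (concat xs))"
    if "mset xs' = mset xs" "\<And>x. x \<in> set xs \<Longrightarrow> even (length x)" for xs xs' :: "'a list list"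
  proof -
    have "set xs' = set xs" using that(1) by (metis set_mset_mset)
    moreover have "(\<Sum>c\<leftarrow>xs'. mset (pair_up c)) = (\<Sum>c\<leftarrow>xs. mset (pair_up c))"
      using that(1) by (metis mset_map sum_mset_sum_list)
    ultimately have "mset (pair_up (concat xs')) = mset (pair_up (concat xs))"
      using that(2) mset_pair_up_concat[of xs'] mset_pair_up_concat[of xs] by simp
    then show ?thesis by (metis set_mset_mset)
  qed
  have "mset (map rotate1 cs') = mset (map rotate1 cs)" using assms(2) by simp
  then have "set (pair_up (concat (map rotate1 cs'))) = set (pair_up (concat (map rotate1 cs)))"
    using assms(1) by (intro pairs) (auto simp: alternating_decomposition_def)
  moreover have "set (pair_up (concat cs')) = set (pair_up (concat cs))"
    using assms by (intro pairs) (auto simp: alternating_decomposition_def)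
  ultimately show ?thesis
    using assms(1) m s mset_eq_imp_distinct_iff[OF m] mset_eq_setD[OF m]
    unfolding alternating_decomposition_def by simp
qed

lemma mset_alternating_decomposition:
  assumes "alternating_decomposition V A B cs"
  shows "mset_set A + mset_set B = sum_list (map cycle_edges cs)"
proof -
  have ev: "\<And>c. c \<in> set cs \<Longrightarrow> even (length c)" and d: "distinct (concat cs)"
    using assms by (auto simp: alternating_decomposition_def)
  have "mset (rotate1 c) = mset c" for c :: "'a list"
    by (cases c) auto
  then have "mset (concat (map rotate1 cs)) = mset (concat cs)"
    by (induction cs) auto
  then have d': "distinct (concat (map rotate1 cs))"
    using d mset_eq_imp_distinct_iff by blast
  have "mset_set A = (\<Sum>c\<leftarrow>cs. mset (pair_up c))"
    using assms ev distinct_pair_up[OF d] mset_pair_up_concat[of cs]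
    by (simp add: alternating_decomposition_def mset_set_set)
  moreover have "mset_set B = (\<Sum>c\<leftarrow>cs. mset (pair_up (rotate1 c)))"
  proof -
    have "even (length c)" if "c \<in> set (map rotate1 cs)" for c
      using that ev by auto
    then show ?thesis
      using assms distinct_pair_up[OF d'] mset_pair_up_concat[of "map rotate1 cs"]
      by (simp add: alternating_decomposition_def mset_set_set comp_def)
  qed
  moreover have "map cycle_edges cs = map (\<lambda>c. mset (pair_up c) + mset (pair_up (rotate1 c))) cs"
    using ev cycle_edges_even by auto
  ultimately show ?thesis by (simp only: sum_list_addf)
qed

section \<open>Existence and uniqueness of the type\<close>

lemma finite_verts: "finite (verts n)"
  by (simp add: verts_def)

lemma identity_matching_perfect: "perfect_matching_on (verts n) (identity_matching n)"
  unfolding perfect_matching_on_def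
proof (intro conjI ballI)
  fix e assume "e \<in> identity_matching n"
  then show "e \<subseteq> verts n" "card e = 2"
    by (auto simp: identity_matching_def verts_def)
next
  fix v assume "v \<in> verts n"
  then obtain i b where "v = (i, b)" "i < n" by (auto simp: verts_def)
  then show "\<exists>!e. e \<in> identity_matching n \<and> v \<in> e"
    by (intro ex1I[of _ "{(i, True), (i, False)}"]) (auto simp: identity_matching_def)
qed

lemma typed_alternating_decomposition_exists:
  assumes "perfect_matching_on (verts n) M"
  obtains cs ls where "alternating_decomposition (verts n) (identity_matching n) M cs"
    "map length cs = map (\<lambda>l. 2 * l) ls" "has_type n M ls"
proof -
  obtain ds where ds: "alternating_decomposition (verts n) (identity_matching n) M ds"
    using alternating_decomposition_exists[OF finite_verts identity_matching_perfect assms] by blast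
  define cs where "cs = rev (sort_key length ds)"
  define ls where "ls = map (\<lambda>c. length c div 2) cs"
  have cs: "alternating_decomposition (verts n) (identity_matching n) M cs"
    by (rule alternating_decomposition_cong_mset[OF ds]) (simp add: cs_def)
  then have ev: "\<And>c. c \<in> set cs \<Longrightarrow> c \<noteq> [] \<and> even (length c)"
    by (simp add: alternating_decomposition_def)
  have len: "map length cs = map (\<lambda>l. 2 * l) ls"
    using ev by (auto simp: ls_def)
  have "sorted (map length (sort_key length ds))" by simp
  then have "sorted_wrt (\<ge>) (map length cs)"
    unfolding cs_def rev_map[symmetric] sorted_wrt_rev by (simp add: sorted_wrt_map)
  then have "sorted_wrt (\<ge>) ls"
    unfolding ls_def sorted_wrt_map by (rule sorted_wrt_mono_rel[rotated]) (auto intro: div_le_mono)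
  moreover have "is_cycle c" if "c \<in> set cs" for c
  proof -
    have "length c \<ge> 2" using ev[OF that] by (cases c rule: pair_up.cases) auto
    moreover have "distinct c"
      using cs that by (auto simp: alternating_decomposition_def distinct_concat_iff)
    ultimately show ?thesis by (simp add: is_cycle_def)
  qed
  ultimately have "has_type n M ls"
    unfolding has_type_def
    using cs len mset_alternating_decomposition[OF cs]
    by (intro conjI exI[of _ cs]) (auto simp: alternating_decomposition_def)
  with cs len that show thesis by blast
qed

text \<open>The connected components, as vertex sets, of the graph with edge set \<open>E\<close>. They depend only
  on \<open>E\<close>, so they can compare different cycle decompositions of the same graph.\<close>

definition components :: "'a set set \<Rightarrow> 'a set set" where
  "components E = (\<lambda>v. {(x, y). {x, y} \<in> E}\<^sup>* `` {v}) ` \<Union>E"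

lemma in_cycle_edges_iff:
  "e \<in># cycle_edges c \<longleftrightarrow> (\<exists>i<length c. e = {c ! i, c ! (Suc i mod length c)})"
proof -
  have "map2 (\<lambda>u v. {u, v}) c (rotate1 c) =
      map (\<lambda>i. {c ! i, c ! (Suc i mod length c)}) [0..<length c]"
    by (rule nth_equalityI) (auto simp: nth_rotate1)
  then show ?thesis by (auto simp: cycle_edges_def simp del: mset_map)
qed

lemma Union_cycle_edges: "is_cycle c \<Longrightarrow> \<Union> (set_mset (cycle_edges c)) = set c"
proof
  assume "is_cycle c"
  show "\<Union> (set_mset (cycle_edges c)) \<subseteq> set c"
  proof
    fix x assume "x \<in> \<Union> (set_mset (cycle_edges c))"
    then obtain i where "i < length c" "x = c ! i \<or> x = c ! (Suc i mod length c)"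
      by (auto simp: in_cycle_edges_iff)
    then show "x \<in> set c" by (metis mod_less_divisor nth_mem gr_zeroI not_less_zero)
  qed
  show "set c \<subseteq> \<Union> (set_mset (cycle_edges c))"
  proof
    fix x assume "x \<in> set c"
    then obtain i where "i < length c" "x = c ! i" by (metis in_set_conv_nth)
    then show "x \<in> \<Union> (set_mset (cycle_edges c))"
      using in_cycle_edges_iff[of "{c ! i, c ! (Suc i mod length c)}" c] by blast
  qed
qed

text \<open>An edge of a cycle cannot leave the cycle, because the cycles are vertex-disjoint, and a
  walk along the cycle reaches all of its vertices.\<close>

lemma components_cycles:
  assumes cyc: "\<And>c. c \<in> set cs \<Longrightarrow> is_cycle c" and d: "distinct (concat cs)"
    and E: "E = (\<Union>c\<in>set cs. set_mset (cycle_edges c))"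
  shows "components E = set ` set cs"
proof -
  let ?R = "{(x, y). {x, y} \<in> E}"
  have "sym ?R" by (auto simp: sym_def insert_commute)
  then have sym: "(x, y) \<in> ?R\<^sup>* \<Longrightarrow> (y, x) \<in> ?R\<^sup>*" for x y
    by (meson sym_rtrancl symD)
  have comp: "?R\<^sup>* `` {v} = set c" if c: "c \<in> set cs" and v: "v \<in> set c" for c v
  proof
    show "?R\<^sup>* `` {v} \<subseteq> set c"
    proof
      fix y assume "y \<in> ?R\<^sup>* `` {v}"
      then have "(v, y) \<in> ?R\<^sup>*" by simp
      then show "y \<in> set c"
      proof induction
        case (step y z)
        then obtain c' where c': "c' \<in> set cs" "{y, z} \<in># cycle_edges c'" by (auto simp: E)
        then have "y \<in> set c'" "z \<in> set c'" using Union_cycle_edges[OF cyc[OF c'(1)]] by auto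
        moreover from this have "c' = c"
          using step.IH c c'(1) d by (auto simp: distinct_concat_iff)
        ultimately show ?case by simp
      qed (use v in simp)
    qed
    have "(c ! 0, c ! i) \<in> ?R\<^sup>*" if "i < length c" for i
      using that
    proof (induction i)
      case (Suc i)
      then have "{c ! i, c ! Suc i} \<in># cycle_edges c"
        by (auto simp: in_cycle_edges_iff intro!: exI[of _ i])
      then have "(c ! i, c ! Suc i) \<in> ?R" using c by (auto simp: E)
      with Suc show ?case by (auto intro: rtrancl.rtrancl_into_rtrancl)
    qed simp
    then have "(c ! 0, x) \<in> ?R\<^sup>*" if "x \<in> set c" for x
      using that by (metis in_set_conv_nth)
    then show "set c \<subseteq> ?R\<^sup>* `` {v}"
      using v sym by (meson Image_singleton_iff rtrancl_trans subsetI)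
  qed
  have "\<Union>E = (\<Union>c\<in>set cs. set c)" using Union_cycle_edges[OF cyc] unfolding E by blast
  then have "components E = (\<Union>c\<in>set cs. (\<lambda>v. ?R\<^sup>* `` {v}) ` set c)"
    by (auto simp: components_def)
  also have "\<dots> = (\<Union>c\<in>set cs. {set c})"
  proof (rule SUP_cong[OF refl])
    fix c assume c: "c \<in> set cs"
    then have "set c \<noteq> {}" using cyc by (fastforce simp: is_cycle_def)
    then show "(\<lambda>v. ?R\<^sup>* `` {v}) ` set c = {set c}"
      by (subst image_cong[OF refl comp[OF c]]) (simp_all add: image_constant_conv)
  qed
  finally show ?thesis by auto
qed

text \<open>The right-hand side does not mention the decomposition that witnesses the type; this is what
  makes the type unique.\<close>

lemma mset_type_eq:
  assumes "perfect_matching_on (verts n) M" "has_type n M ls"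
  shows "image_mset (\<lambda>l. 2 * l) (mset ls) =
    image_mset card (mset_set (components (identity_matching n \<union> M)))"
proof -
  obtain cs where cyc: "\<forall>c\<in>set cs. is_cycle c" and d: "distinct (concat cs)"
    and edges: "mset_set (identity_matching n) + mset_set M = sum_list (map cycle_edges cs)"
    and len: "map length cs = map (\<lambda>l. 2 * l) ls"
    using assms(2) by (auto simp: has_type_def)
  have "M \<subseteq> Pow (verts n)" "identity_matching n \<subseteq> Pow (verts n)"
    using assms(1) identity_matching_perfect by (auto simp: perfect_matching_on_def)
  then have fin: "finite M" "finite (identity_matching n)"
    using finite_verts by (meson finite_Pow_iff finite_subset)+
  have "identity_matching n \<union> M = set_mset (sum_list (map cycle_edges cs))"
    using fin arg_cong[OF edges, of set_mset] by simp
  also have "\<dots> = (\<Union>c\<in>set cs. set_mset (cycle_edges c))"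
    by (induction cs) auto
  finally have comp: "components (identity_matching n \<union> M) = set ` set cs"
    using components_cycles[OF _ d] cyc by blast
  have "distinct cs" and inj: "inj_on set (set cs)"
  proof -
    have ne: "set c \<noteq> {}" if "c \<in> set cs" for c
      using cyc that by (fastforce simp: is_cycle_def)
    then have "[] \<notin> set cs" by force
    then have "removeAll [] cs = cs" by (simp add: removeAll_id)
    then show "distinct cs" using d by (simp add: distinct_concat_iff)
    show "inj_on set (set cs)"
      using d ne by (intro inj_onI) (metis distinct_concat_iff inf.idem)
  qed
  have "image_mset card (mset_set (set ` set cs)) = image_mset (\<lambda>c. card (set c)) (mset cs)"
    using \<open>distinct cs\<close> inj
    by (simp add: image_mset_mset_set[symmetric] mset_set_set multiset.map_comp comp_def)
  also have "\<dots> = image_mset length (mset cs)"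
    using cyc by (intro image_mset_cong) (auto simp: is_cycle_def distinct_card)
  also have "\<dots> = image_mset (\<lambda>l. 2 * l) (mset ls)" using len by (metis mset_map)
  finally show ?thesis using comp by simp
qed

lemma has_type_unique:
  assumes "perfect_matching_on (verts n) M" "has_type n M ls" "has_type n M ls'"
  shows "ls = ls'"
proof -
  have "image_mset (\<lambda>l. 2 * l) (mset ls) = image_mset (\<lambda>l. 2 * l) (mset ls')"
    using assms mset_type_eq by metis
  from arg_cong[OF this, of "image_mset (\<lambda>l. l div 2)"] have "mset (rev ls) = mset (rev ls')"
    by (simp add: multiset.map_comp comp_def)
  moreover have "sorted (rev ls)" "sorted (rev ls')"
    using assms(2,3) by (auto simp: has_type_def sorted_wrt_rev)
  ultimately have "rev ls = rev ls'" by (metis properties_for_sort)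
  then show ?thesis by simp
qed

section \<open>Vertex permutations that fix the identity matching\<close>

text \<open>Decompose both unions into alternating cycles and send each vertex to the vertex at the same
  position of the other list of cycles. Equal types make the cycle lengths agree, so cycles are
  sent to cycles; since each cycle starts with an edge of the identity matching, its
  edges of either kind are sent to edges of the same kind.\<close>

lemma relabelling_exists:
  assumes M: "perfect_matching_on (verts n) M" "has_type n M ls"
    and N: "perfect_matching_on (verts n) N" "has_type n N ls"
  obtains f where "f permutes verts n" "(`) f ` identity_matching n = identity_matching n"
    "(`) f ` M = N"
proof -
  obtain cs where cs: "alternating_decomposition (verts n) (identity_matching n) M cs"
    and lc: "map length cs = map (\<lambda>l. 2 * l) ls"
    using typed_alternating_decomposition_exists[OF M(1)] has_type_unique[OF M(1) M(2)] by metis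
  obtain ds where ds: "alternating_decomposition (verts n) (identity_matching n) N ds"
    and ld: "map length ds = map (\<lambda>l. 2 * l) ls"
    using typed_alternating_decomposition_exists[OF N(1)] has_type_unique[OF N(1) N(2)] by metis
  let ?xs = "concat cs" and ?ys = "concat ds"
  have dist: "distinct ?xs" "distinct ?ys" and sets: "set ?xs = verts n" "set ?ys = verts n"
    using cs ds by (auto simp: alternating_decomposition_def)
  have len: "length ?xs = length ?ys" using lc ld by (simp add: length_concat)
  define g where "g = the \<circ> map_of (zip ?xs ?ys)"
  define f where "f x = (if x \<in> verts n then g x else x)" for x
  have g: "g (?xs ! i) = ?ys ! i" if "i < length ?xs" for i
    using that len dist by (simp add: g_def map_of_zip_nth)
  have f: "map f ?xs = ?ys"
    using g len sets(1) nth_mem[of _ ?xs] by (intro nth_equalityI) (simp_all add: f_def)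
  have "bij_betw f (verts n) (verts n)"
    using f dist sets by (metis bij_betw_def distinct_map image_set)
  then have perm: "f permutes verts n"
    by (rule bij_imp_permutes) (simp add: f_def)
  \<comment> \<open>The two concatenations are cut at the same positions, so \<open>f\<close> respects the single cycles;
    only then does it commute with rotating each of them.\<close>
  have "concat (map (map f) cs) = concat ds" using f by (simp add: map_concat)
  moreover from lc ld have "length (map (map f) cs) = length ds"
    by (metis length_map)
  moreover from lc ld have "length (cs ! i) = length (ds ! i)"
    if "i < length cs" "i < length ds" for i
    using that by (metis nth_map)
  then have "\<forall>(x, y)\<in>set (zip (map (map f) cs) ds). length x = length y"
    by (auto simp: in_set_zip)
  ultimately have fcs: "map (map f) cs = ds"
    by (rule concat_injective)
  have frot: "map f (concat (map rotate1 cs)) = concat (map rotate1 ds)"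
    unfolding fcs[symmetric] by (simp add: map_concat comp_def rotate1_map)
  have pairs: "(`) f ` set (pair_up xs) = set (pair_up (map f xs))" for xs
    by (simp add: pair_up_map)
  have "M = set (pair_up (concat (map rotate1 cs)))" "N = set (pair_up (concat (map rotate1 ds)))"
    using cs ds unfolding alternating_decomposition_def by blast+
  then have "(`) f ` M = N"
    by (simp only: pairs frot)
  moreover have "identity_matching n = set (pair_up ?xs)" "identity_matching n = set (pair_up ?ys)"
    using cs ds unfolding alternating_decomposition_def by blast+
  then have "(`) f ` identity_matching n = identity_matching n"
    using pairs[of ?xs] by (simp only: f)
  ultimately show thesis using that perm by blast
qed

lemma perfect_matching_on_relabel:
  assumes f: "f permutes V" and M: "perfect_matching_on V M"
  shows "perfect_matching_on V ((`) f ` M)"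
  unfolding perfect_matching_on_def
proof (intro conjI ballI)
  fix e assume "e \<in> (`) f ` M"
  then obtain e' where e': "e = f ` e'" "e' \<subseteq> V" "card e' = 2"
    using M by (auto simp: perfect_matching_on_def)
  then show "e \<subseteq> V" using permutes_image[OF f] by blast
  show "card e = 2" using e' card_image[of f e'] permutes_inj_on[OF f] by simp
next
  fix v assume "v \<in> V"
  then obtain u where u: "u \<in> V" "v = f u" using permutes_image[OF f] by blast
  then obtain e where e: "e \<in> M" "u \<in> e" "\<And>e'. e' \<in> M \<Longrightarrow> u \<in> e' \<Longrightarrow> e' = e"
    using M unfolding perfect_matching_on_def by metis
  show "\<exists>!e. e \<in> (`) f ` M \<and> v \<in> e"
  proof (rule ex1I[of _ "f ` e"])
    show "f ` e \<in> (`) f ` M \<and> v \<in> f ` e" using e(1,2) u(2) by blast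
    show "d = f ` e" if "d \<in> (`) f ` M \<and> v \<in> d" for d
      using that e(3) u(2) inj_image_mem_iff[OF permutes_inj[OF f]] by blast
  qed
qed

lemma flip_adj_relabel:
  assumes f: "inj f" and "flip_adj M N"
  shows "flip_adj ((`) f ` M) ((`) f ` N)"
proof -
  obtain vs where vs: "is_cycle vs" "length vs = 4"
    "(M - N) \<union> (N - M) = set_mset (cycle_edges vs)"
    using assms(2) by (auto simp: flip_adj_def)
  have "inj ((`) f)" using f by (simp add: inj_image_eq_iff inj_on_def)
  then have "((`) f ` M - (`) f ` N) \<union> ((`) f ` N - (`) f ` M) = (`) f ` ((M - N) \<union> (N - M))"
    by (simp add: image_set_diff image_Un)
  then show ?thesis
    unfolding flip_adj_def using vs f
    by (intro exI[of _ "map f vs"]) (simp add: is_cycle_map cycle_edges_map)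
qed

lemma has_type_relabel:
  assumes f: "inj f" and fix_id: "(`) f ` identity_matching n = identity_matching n"
    and "has_type n M ls"
  shows "has_type n ((`) f ` M) ls"
proof -
  obtain cs where ls: "sorted_wrt (\<ge>) ls" and cyc: "\<forall>c\<in>set cs. is_cycle c"
    and d: "distinct (concat cs)"
    and edges: "mset_set (identity_matching n) + mset_set M = sum_list (map cycle_edges cs)"
    and len: "map length cs = map (\<lambda>l. 2 * l) ls"
    using assms(3) by (auto simp: has_type_def)
  have "inj ((`) f)" using f by (simp add: inj_image_eq_iff inj_on_def)
  then have img: "mset_set ((`) f ` X) = image_mset ((`) f) (mset_set X)" for X
    by (metis image_mset_mset_set inj_on_subset subset_UNIV)
  have "mset_set (identity_matching n) + mset_set ((`) f ` M) =
      image_mset ((`) f) (mset_set (identity_matching n) + mset_set M)"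
    using img[of M] img[of "identity_matching n"] fix_id by simp
  also have "\<dots> = sum_list (map cycle_edges (map (map f) cs))"
    unfolding edges by (induction cs) (simp_all add: cycle_edges_map)
  finally have "mset_set (identity_matching n) + mset_set ((`) f ` M) =
      sum_list (map cycle_edges (map (map f) cs))" .
  moreover have "distinct (concat (map (map f) cs))"
    using d f by (metis distinct_map inj_on_subset map_concat subset_UNIV)
  ultimately show ?thesis
    unfolding has_type_def using ls cyc len f
    by (intro conjI exI[of _ "map (map f) cs"]) (auto simp: is_cycle_map comp_def)
qed

section \<open>The partition into types\<close>

lemma finite_perfect_matchings: "finite (perfect_matchings n)"
proof (rule finite_subset)
  show "perfect_matchings n \<subseteq> Pow (Pow (verts n))"
    by (auto simp: perfect_matchings_eq perfect_matching_on_def)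
qed (simp add: finite_verts)

text \<open>Relabelling \<open>M\<close> to \<open>N\<close> injects one set of flips into the other. An inequality suffices, as
  exchanging \<open>M\<close> and \<open>N\<close> gives the converse.\<close>

lemma card_flips_into_type_le:
  assumes "M \<in> matchings_of_type n ls" "N \<in> matchings_of_type n ls"
  shows "card {M' \<in> matchings_of_type n ks. flip_adj M M'} \<le>
    card {N' \<in> matchings_of_type n ks. flip_adj N N'}"
proof -
  obtain f where f: "f permutes verts n" "(`) f ` identity_matching n = identity_matching n"
    and MN: "(`) f ` M = N"
    using relabelling_exists[of n M ls N] assms
    by (auto simp: matchings_of_type_def perfect_matchings_eq)
  have inj: "inj f" by (rule permutes_inj[OF f(1)])
  show ?thesis
  proof (rule card_inj_on_le)
    show "inj_on ((`) ((`) f)) {M' \<in> matchings_of_type n ks. flip_adj M M'}"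
      using inj by (simp add: inj_image_eq_iff inj_on_def)
    show "(`) ((`) f) ` {M' \<in> matchings_of_type n ks. flip_adj M M'} \<subseteq>
        {N' \<in> matchings_of_type n ks. flip_adj N N'}"
      using perfect_matching_on_relabel[OF f(1)] has_type_relabel[OF inj f(2)]
        flip_adj_relabel[OF inj, of M] MN
      by (auto simp: matchings_of_type_def perfect_matchings_eq)
    show "finite {N' \<in> matchings_of_type n ks. flip_adj N N'}"
      using finite_perfect_matchings by (simp add: matchings_of_type_def)
  qed
qed

theorem proposition3p1:
  fixes n :: nat
  assumes "n \<ge> 1"
  shows "equitable_partition (perfect_matchings n) flip_adj (matching_types n) (matchings_of_type n)"
  unfolding equitable_partition_def
proof (intro conjI)
  have unique: "ls = ls'" if "M \<in> perfect_matchings n" "has_type n M ls" "has_type n M ls'"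
    for M ls ls'
    using that has_type_unique by (auto simp: perfect_matchings_eq)
  have "finite {ls. has_type n M ls}" if "M \<in> perfect_matchings n" for M
  proof (cases "\<exists>ls. has_type n M ls")
    case True
    then obtain ls where "has_type n M ls" ..
    then have "{ls. has_type n M ls} \<subseteq> {ls}" using unique[OF that] by blast
    then show ?thesis by (rule finite_subset) simp
  qed simp
  moreover have "matching_types n = (\<Union>M\<in>perfect_matchings n. {ls. has_type n M ls})"
    by (auto simp: matching_types_def)
  ultimately show "finite (matching_types n)"
    using finite_perfect_matchings by simp
  show "(\<Union>i\<in>matching_types n. matchings_of_type n i) = perfect_matchings n"
  proof
    show "perfect_matchings n \<subseteq> (\<Union>i\<in>matching_types n. matchings_of_type n i)"
    proof
      fix M assume M: "M \<in> perfect_matchings n"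
      then obtain ls where "has_type n M ls"
        using typed_alternating_decomposition_exists[of n M] by (auto simp: perfect_matchings_eq)
      with M show "M \<in> (\<Union>i\<in>matching_types n. matchings_of_type n i)"
        by (auto simp: matchings_of_type_def matching_types_def)
    qed
  qed (auto simp: matchings_of_type_def)
  show "disjoint_family_on (matchings_of_type n) (matching_types n)"
    using unique by (auto simp: disjoint_family_on_def matchings_of_type_def)
  show "\<forall>i\<in>matching_types n. matchings_of_type n i \<noteq> {}"
    by (auto simp: matchings_of_type_def matching_types_def)
  show "\<exists>b. \<forall>i\<in>matching_types n. \<forall>j\<in>matching_types n. \<forall>x\<in>matchings_of_type n i.
      card {y \<in> matchings_of_type n j. flip_adj x y} = b i j"
  proof (intro exI ballI)
    fix i j M assume M: "M \<in> matchings_of_type n i"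
    let ?N = "SOME N. N \<in> matchings_of_type n i"
    have N: "?N \<in> matchings_of_type n i" using M by (rule someI)
    show "card {y \<in> matchings_of_type n j. flip_adj M y} =
        (\<lambda>i j. card {y \<in> matchings_of_type n j. flip_adj (SOME N. N \<in> matchings_of_type n i) y}) i j"
      using card_flips_into_type_le[OF M N] card_flips_into_type_le[OF N M] by (simp add: le_antisym)
  qed
qed

end
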